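(* Let $H$ be a hypergraph, with vertex and hyperedge weight functions $w_V:V(H)\to(0,\infty)$ and $w_E:E(H)\to(0,\infty)$ and associated signless Laplacian matrix $Q_H$. If $U$ is a linearly dependent set of vertices in $H$ with a coefficient vector $c_U$, then $Q_Hc_U=0$.
   Context: A hypergraph $H=(V(H),E(H))$ consists of a finite non-empty vertex set $V(H)$ and a set $E(H)\subseteq\mathcal{P}(V(H))$ of hyperedges. The incidence matrix $I_H=[i_{ve}]_{v\in V(H),e\in E(H)}$ has $i_{ve}=1$ if $v\in e$ and $0$ otherwise. For $v\in V(H)$ let $s_v:E(H)\to\{0,1\}$, $s_v(e)=i_{ve}$. A set $U\subseteq V(H)$ is linearly dependent if the family $(s_v)_{v\in U}$ (indexed by $U$) is linearly dependent. A coefficient vector of such a $U$ is a non-zero function $c_U:V(H)\to\mathbb{R}$ with $c_U(v)=0$ for $v\notin U$ and $\sum_{v\in U}c_U(v)s_v=0$. The signless Laplacian matrix is $Q_H=[q_{uv}]_{u,v\in V(H)}$ with $q_{uv}=\sum_{e\in E(H)}w_V(u)\,i_{ue}\,i_{ve}\,w_E(e)$. *)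

theory Defs
  imports Complex_Main
begin

text \<open>
  A hypergraph is given by its vertex set \<open>V\<close> and its hyperedge set \<open>E\<close>. Functions on \<open>V\<close> or \<open>E\<close> are
  total HOL functions of which only the values on the carrier are used, so that vanishing and
  equality are always stated relative to the carrier.
\<close>

locale hypergraph =
  fixes V :: "'a set" and E :: "'a set set"
  assumes finite_vertices: "finite V"
    and nonempty_vertices: "V \<noteq> {}"
    and hyperedges_subset: "E \<subseteq> Pow V"

definition incidence :: "'a \<Rightarrow> 'a set \<Rightarrow> real" where
  "incidence v e = (if v \<in> e then 1 else 0)"

text \<open>The vector \<open>s\<^sub>v\<close>, i.e. the row of the incidence matrix indexed by \<open>v\<close>.\<close>

definition incidence_vector :: "'a \<Rightarrow> 'a set \<Rightarrow> real" where
  "incidence_vector v = (\<lambda>e. incidence v e)"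

text \<open>
  Linear dependence of the family \<open>(s\<^sub>v)\<close> indexed by \<open>U\<close>, in the space of real functions on \<open>E\<close>. This is
  not the library's \<open>dependent\<close> applied to the set of the \<open>s\<^sub>v\<close>: two distinct vertices with the same
  incidence vector make \<open>U\<close> dependent.
\<close>

definition linearly_dependent_vertices :: "'a set \<Rightarrow> 'a set set \<Rightarrow> 'a set \<Rightarrow> bool" where
  "linearly_dependent_vertices V E U \<longleftrightarrow>
     U \<subseteq> V \<and>
     (\<exists>a :: 'a \<Rightarrow> real. (\<exists>v\<in>U. a v \<noteq> 0) \<and>
        (\<forall>e\<in>E. (\<Sum>v\<in>U. a v * incidence_vector v e) = 0))"

definition coefficient_vector ::
    "'a set \<Rightarrow> 'a set set \<Rightarrow> 'a set \<Rightarrow> ('a \<Rightarrow> real) \<Rightarrow> bool" where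
  "coefficient_vector V E U c \<longleftrightarrow>
     (\<exists>v\<in>V. c v \<noteq> 0) \<and>
     (\<forall>v\<in>V - U. c v = 0) \<and>
     (\<forall>e\<in>E. (\<Sum>v\<in>U. c v * incidence_vector v e) = 0)"

definition signless_laplacian ::
    "'a set set \<Rightarrow> ('a \<Rightarrow> real) \<Rightarrow> ('a set \<Rightarrow> real) \<Rightarrow> 'a \<Rightarrow> 'a \<Rightarrow> real" where
  "signless_laplacian E wV wE u v =
     (\<Sum>e\<in>E. wV u * incidence u e * incidence v e * wE e)"

text \<open>Product of a matrix with columns indexed by the finite set \<open>V\<close> and a vector on \<open>V\<close>.\<close>

definition matrix_vector_on :: "'a set \<Rightarrow> ('a \<Rightarrow> 'a \<Rightarrow> real) \<Rightarrow> ('a \<Rightarrow> real) \<Rightarrow> 'a \<Rightarrow> real" where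
  "matrix_vector_on V M x u = (\<Sum>v\<in>V. M u v * x v)"

end

theory Submission
  imports Defs
begin

text \<open>
  The signless Laplacian factors as \<open>Q = W\<^sub>V I W\<^sub>E I\<^sup>T\<close> with \<open>I\<close> the incidence matrix and \<open>W\<^sub>V\<close>, \<open>W\<^sub>E\<close>
  the diagonal weight matrices, so its kernel contains that of \<open>I\<^sup>T\<close>. Since \<open>c\<close> vanishes outside \<open>U\<close>,
  the linear relation among the rows of \<open>I\<close> says exactly that \<open>I\<^sup>T c = 0\<close>. Lemma
  \<open>signless_laplacian_factorization\<close> gives the first fact and \<open>coefficient_vector_sum_over_vertices\<close>
  the second.
\<close>

text \<open>
  This is \<open>Q x = W\<^sub>V I W\<^sub>E (I\<^sup>T x)\<close> written out at the row \<open>u\<close>: the inner sum is the entry of \<open>I\<^sup>T x\<close>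
  at the hyperedge \<open>e\<close>. It comes from exchanging the sums over vertices and hyperedges.
\<close>

lemma signless_laplacian_factorization:
  "matrix_vector_on V (signless_laplacian E wV wE) x u =
     (\<Sum>e\<in>E. wV u * incidence u e * wE e * (\<Sum>v\<in>V. x v * incidence_vector v e))"
proof -
  have "matrix_vector_on V (signless_laplacian E wV wE) x u =
      (\<Sum>v\<in>V. \<Sum>e\<in>E. wV u * incidence u e * wE e * (x v * incidence_vector v e))"
    by (simp add: matrix_vector_on_def signless_laplacian_def incidence_vector_def
        sum_distrib_left mult_ac)
  also have "\<dots> = (\<Sum>e\<in>E. \<Sum>v\<in>V. wV u * incidence u e * wE e * (x v * incidence_vector v e))"
    by (rule sum.swap)
  finally show ?thesis
    by (simp add: sum_distrib_left)
qed

text \<open>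
  The relation satisfied by \<open>c\<close> is a sum over \<open>U\<close> only; the vertices outside \<open>U\<close> have coefficient
  zero, so it extends to a relation over all of \<open>V\<close>, as the matrix product requires.
\<close>

lemma coefficient_vector_sum_over_vertices:
  assumes "finite V" and "U \<subseteq> V" and "coefficient_vector V E U c" and "e \<in> E"
  shows "(\<Sum>v\<in>V. c v * incidence_vector v e) = 0"
proof -
  have "(\<Sum>v\<in>U. c v * incidence_vector v e) = (\<Sum>v\<in>V. c v * incidence_vector v e)"
    using assms by (intro sum.mono_neutral_left) (auto simp: coefficient_vector_def)
  then show ?thesis
    using assms by (simp add: coefficient_vector_def)
qed

theorem proposition3p2:
  fixes V :: "'a set" and E :: "'a set set"
    and wV :: "'a \<Rightarrow> real" and wE :: "'a set \<Rightarrow> real"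
    and U :: "'a set" and c :: "'a \<Rightarrow> real"
  assumes "hypergraph V E"
    and "\<forall>v\<in>V. wV v > 0"
    and "\<forall>e\<in>E. wE e > 0"
    and "linearly_dependent_vertices V E U"
    and "coefficient_vector V E U c"
  shows "\<forall>u\<in>V. matrix_vector_on V (signless_laplacian E wV wE) c u = 0"
proof -
  have "finite V"
    using assms(1) by (rule hypergraph.finite_vertices)
  moreover have "U \<subseteq> V"
    using assms(4) by (simp add: linearly_dependent_vertices_def)
  ultimately have "(\<Sum>v\<in>V. c v * incidence_vector v e) = 0" if "e \<in> E" for e
    using assms(5) that by (rule coefficient_vector_sum_over_vertices)
  then show ?thesis
    by (simp add: signless_laplacian_factorization)
qed

end
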